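(* For all integers $l, m, n \geq 0$, \[ \mathscr{D}_{2m}^{(-2l)}(n)=\mathscr{D}_{2l}^{(-2m)}(n), \] where $\mathscr{D}_m^{(-l)}(n)$ denotes the symmetrized polycosecant numbers defined in the context.
   Context: For $k\in\mathbb{Z}$ and $|z|<1$, the polylogarithm is $\mathrm{Li}_k(z)=\sum_{n=1}^{\infty} z^n/n^k$; for $k\le 0$ it is a rational function of $z$. The unsigned Stirling numbers of the first kind $\left[{n\atop j}\right]$ are defined by $x(x+1)\cdots(x+n-1)=\sum_{j=0}^{n}\left[{n\atop j}\right]x^j$, with $\left[{0\atop 0}\right]=1$. For integers $l,n\ge 0$, define numbers $D_m^{(-l)}(n)$ ($m\ge 0$) by the generating function \[ \frac{1}{2}(e^t+1)^{1-n}\frac{\mathrm{Li}_{-l}(\tanh(t/2))}{\sinh t}+\frac{1}{2}(e^{-t}+1)^{1-n}\frac{\mathrm{Li}_{-l}(-\tanh(t/2))}{\sinh(-t)}=\sum_{m=0}^{\infty}D_m^{(-l)}(n)\frac{t^m}{m!}. \] The symmetrized polycosecant numbers are \[ \mathscr{D}_m^{(-l)}(n)=\sum_{j=0}^{n}\left[{n\atop j}\right]D_m^{(-l-j)}(n). \] *)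

theory Defs
  imports "HOL-Complex_Analysis.Complex_Analysis" "HOL-Combinatorics.Stirling"
begin

definition fps_sinh :: "complex \<Rightarrow> complex fps" where
  "fps_sinh c = fps_const (1/2) * (fps_exp c - fps_exp (- c))"

definition fps_cosh :: "complex \<Rightarrow> complex fps" where
  "fps_cosh c = fps_const (1/2) * (fps_exp c + fps_exp (- c))"

definition fps_tanh :: "complex \<Rightarrow> complex fps" where
  "fps_tanh c = fps_sinh c / fps_cosh c"

definition polylog_fps :: "int \<Rightarrow> complex fps" where
  "polylog_fps k = Abs_fps (\<lambda>n. if n = 0 then 0 else 1 / of_nat n powi k)"

text \<open>The upper index \<open>-l\<close> is represented by the natural number \<open>l\<close>.  The division by
  \<open>fps_sinh (\<plusminus>1)\<close> is exact: numerator and denominator have no constant term and the latter has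
  subdegree 1.  The lemma \<open>polycosecant_generating_function\<close> below shows that the series does
  converge to the function it stands for.\<close>
definition polycosecant_gf :: "nat \<Rightarrow> nat \<Rightarrow> complex fps" where
  "polycosecant_gf l n =
     fps_const (1/2) * (fps_exp 1 + 1) powi (1 - int n) *
       ((polylog_fps (- int l) oo fps_tanh (1/2)) / fps_sinh 1) +
     fps_const (1/2) * (fps_exp (- 1) + 1) powi (1 - int n) *
       ((polylog_fps (- int l) oo (- fps_tanh (1/2))) / fps_sinh (- 1))"

text \<open>\<open>polycosecant m l n\<close> is $D_m^{(-l)}(n)$.\<close>
definition polycosecant :: "nat \<Rightarrow> nat \<Rightarrow> nat \<Rightarrow> complex" where
  "polycosecant m l n = fact m * fps_nth (polycosecant_gf l n) m"

definition sym_polycosecant :: "nat \<Rightarrow> nat \<Rightarrow> nat \<Rightarrow> complex" where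
  "sym_polycosecant m l n = (\<Sum>j=0..n. of_nat (stirling n j) * polycosecant m (l + j) n)"


subsection \<open>The formal series agree with the analytic functions\<close>

definition polylog :: "int \<Rightarrow> complex \<Rightarrow> complex" where
  "polylog k z = (\<Sum>n. z ^ Suc n / of_nat (Suc n) powi k)"

lemma fps_conv_radius_polylog_fps: "fps_conv_radius (polylog_fps k) = 1"
proof -
  have lim: "(\<lambda>n. ((of_nat (Suc n) / of_nat n) :: real) powi k) \<longlonglongrightarrow> 1 powi k"
    by (intro tendsto_power_int LIMSEQ_Suc_n_over_n) auto
  have "(\<lambda>n. norm (fps_nth (polylog_fps k) n) / norm (fps_nth (polylog_fps k) (Suc n))) \<longlonglongrightarrow> 1"
  proof (rule Lim_transform_eventually)
    show "(\<lambda>n. ((of_nat (Suc n) / of_nat n) :: real) powi k) \<longlonglongrightarrow> 1" using lim by simp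
    show "\<forall>\<^sub>F n in sequentially. ((of_nat (Suc n) / of_nat n) :: real) powi k =
            norm (fps_nth (polylog_fps k) n) / norm (fps_nth (polylog_fps k) (Suc n))"
      using eventually_gt_at_top[of 0]
      by eventually_elim
        (simp add: polylog_fps_def norm_divide norm_power_int power_int_divide_distrib
           norm_of_nat del: of_nat_Suc)
  qed
  then show ?thesis
    unfolding fps_conv_radius_def
    by (intro conv_radius_ratio_limit_nonzero[of _ 1])
      (auto simp: polylog_fps_def one_ereal_def simp del: of_nat_Suc)
qed

lemma eval_polylog_fps:
  assumes "norm z < 1"
  shows "eval_fps (polylog_fps k) z = polylog k z"
proof -
  have "summable (\<lambda>n. fps_nth (polylog_fps k) n * z ^ n)"
    using assms by (intro summable_fps) (simp add: fps_conv_radius_polylog_fps)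
  then have "(\<Sum>n. fps_nth (polylog_fps k) n * z ^ n) =
      (\<Sum>n. fps_nth (polylog_fps k) (Suc n) * z ^ Suc n)"
    by (subst suminf_split_head) (auto simp: polylog_fps_def)
  then show ?thesis
    by (simp add: eval_fps_def polylog_def polylog_fps_def del: of_nat_Suc)
qed

lemma polylog_has_fps_expansion: "polylog k has_fps_expansion polylog_fps k"
proof -
  have "eventually (\<lambda>z. z \<in> ball (0::complex) 1) (nhds 0)"
    by (intro eventually_nhds_in_open) auto
  then have "eventually (\<lambda>z. eval_fps (polylog_fps k) z = polylog k z) (nhds 0)"
    by eventually_elim (auto intro: eval_polylog_fps)
  then show ?thesis
    by (simp add: has_fps_expansion_def fps_conv_radius_polylog_fps)
qed

lemma sinh_has_fps_expansion: "(\<lambda>t. sinh (c * t)) has_fps_expansion fps_sinh c"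
proof -
  have "(\<lambda>t. (1/2) * (exp (c * t) - exp (- c * t))) has_fps_expansion fps_sinh c"
    unfolding fps_sinh_def by (intro fps_expansion_intros)
  then show ?thesis by (simp add: sinh_field_def)
qed

lemma cosh_has_fps_expansion: "(\<lambda>t. cosh (c * t)) has_fps_expansion fps_cosh c"
proof -
  have "(\<lambda>t. (1/2) * (exp (c * t) + exp (- c * t))) has_fps_expansion fps_cosh c"
    unfolding fps_cosh_def by (intro fps_expansion_intros)
  then show ?thesis by (simp add: cosh_field_def)
qed

lemma tanh_has_fps_expansion: "(\<lambda>t. tanh (c * t)) has_fps_expansion fps_tanh c"
proof -
  have "(\<lambda>t. sinh (c * t) / cosh (c * t)) has_fps_expansion fps_tanh c"
    unfolding fps_tanh_def
    by (intro has_fps_expansion_divide' sinh_has_fps_expansion cosh_has_fps_expansion)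
      (simp add: fps_cosh_def)
  then show ?thesis by (simp add: tanh_def)
qed

lemma power_has_fps_expansion:
  assumes "f has_fps_expansion (F :: complex fps)"
  shows "(\<lambda>t. f t ^ n) has_fps_expansion F ^ n"
  by (induction n) (auto intro!: has_fps_expansion_mult assms)

lemma powi_has_fps_expansion:
  assumes "f has_fps_expansion (F :: complex fps)" "fps_nth F 0 \<noteq> 0"
  shows "(\<lambda>t. f t powi k) has_fps_expansion F powi k"
  unfolding power_int_def using assms
  by (cases "k \<ge> 0") (auto intro!: power_has_fps_expansion has_fps_expansion_inverse)

lemma polycosecant_generating_function:
  "\<forall>\<^sub>F t in at 0. (\<lambda>m. polycosecant m l n * t ^ m / fact m) sums
     (1/2 * (exp t + 1) powi (1 - int n) * (polylog (- int l) (tanh (t/2)) / sinh t) +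
      1/2 * (exp (- t) + 1) powi (1 - int n) * (polylog (- int l) (- tanh (t/2)) / sinh (- t)))"
proof -
  let ?P = "polylog_fps (- int l)" and ?p = "polylog (- int l)"
  let ?T = "fps_tanh (1/2)"
  have tanh: "(\<lambda>t. tanh (t/2)) has_fps_expansion ?T"
    using tanh_has_fps_expansion[of "1/2"] by simp
  have T0: "fps_nth ?T 0 = 0"
    by (simp add: fps_tanh_def fps_sinh_def fps_cosh_def fps_divide_unit)
  have sub: "subdegree (fps_sinh c) = 1" "fps_sinh c \<noteq> 0" if "c \<noteq> 0" for c
  proof -
    have *: "fps_nth (fps_sinh c) 0 = 0" "fps_nth (fps_sinh c) 1 = c"
      by (simp_all add: fps_sinh_def)
    then show "subdegree (fps_sinh c) = 1" using that by (intro subdegreeI) auto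
    show "fps_sinh c \<noteq> 0" using * that by auto
  qed
  define A where "A G c = (?P oo G) / fps_sinh c" for G c
  have quot: "\<exists>a. (\<lambda>t. if t = 0 then a else ?p (g t) / sinh (c * t)) has_fps_expansion A G c"
    if g: "g has_fps_expansion G" "fps_nth G 0 = 0" and c: "c \<noteq> 0" for g G c
  proof (cases "?P oo G = 0")
    case True
    have "(?p \<circ> g) has_fps_expansion (?P oo G)"
      by (intro has_fps_expansion_compose polylog_has_fps_expansion g)
    then have ev: "\<forall>\<^sub>F t in nhds 0. ?p (g t) = 0"
      using True by (simp add: has_fps_expansion_0_iff)
    have "(\<lambda>t. if t = 0 then 0 else ?p (g t) / sinh (c * t)) has_fps_expansion 0"
      unfolding has_fps_expansion_0_iff using ev by eventually_elim auto
    then show ?thesis using True by (auto simp: A_def)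
  next
    case False
    have "(?p \<circ> g) has_fps_expansion (?P oo G)"
      by (intro has_fps_expansion_compose polylog_has_fps_expansion g)
    moreover have "subdegree (fps_sinh c) \<le> subdegree (?P oo G)"
    proof -
      have "fps_nth (?P oo G) 0 = 0"
        by (simp add: fps_compose_def polylog_fps_def)
      with False have "subdegree (?P oo G) \<noteq> 0" by (metis nth_subdegree_zero_iff)
      with sub(1)[OF c] show ?thesis by simp
    qed
    ultimately show ?thesis
      using has_fps_expansion_divide[OF _ sinh_has_fps_expansion[of c] _ sub(2)[OF c] refl]
      unfolding A_def o_def by blast
  qed
  obtain a where a: "(\<lambda>t. if t = 0 then a else ?p (tanh (t/2)) / sinh (1 * t)) has_fps_expansion A ?T 1"
    using quot[OF tanh T0, of 1] by auto
  have mtanh: "(\<lambda>t. - tanh (t/2)) has_fps_expansion (- ?T)"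
    by (intro fps_expansion_intros tanh)
  obtain b where b: "(\<lambda>t. if t = 0 then b else ?p (- tanh (t/2)) / sinh (- 1 * t)) has_fps_expansion A (- ?T) (- 1)"
    using quot[OF mtanh, of "- 1"] T0 by auto
  have e: "(\<lambda>t. (exp (c * t) + 1) powi (1 - int n)) has_fps_expansion (fps_exp c + 1) powi (1 - int n)" for c :: complex
    by (intro powi_has_fps_expansion fps_expansion_intros) auto
  let ?f = "\<lambda>t. 1/2 * (exp (1 * t) + 1) powi (1 - int n) * (if t = 0 then a else ?p (tanh (t/2)) / sinh (1 * t)) +
     1/2 * (exp (- 1 * t) + 1) powi (1 - int n) * (if t = 0 then b else ?p (- tanh (t/2)) / sinh (- 1 * t))"
  have F: "?f has_fps_expansion polycosecant_gf l n"
    unfolding polycosecant_gf_def A_def[symmetric]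
    by (intro has_fps_expansion_add has_fps_expansion_mult e a b has_fps_expansion_const)
  then have "\<forall>\<^sub>F t in nhds 0. eval_fps (polycosecant_gf l n) t = ?f t"
    by (simp add: has_fps_expansion_def)
  moreover have "\<forall>\<^sub>F t in nhds 0. t \<in> eball 0 (fps_conv_radius (polycosecant_gf l n))"
    using F by (intro eventually_nhds_in_open) (auto simp: has_fps_expansion_def zero_ereal_def)
  ultimately have "\<forall>\<^sub>F t in nhds 0. (\<lambda>m. polycosecant m l n * t ^ m / fact m) sums ?f t"
  proof eventually_elim
    case (elim t)
    then have "(\<lambda>m. fps_nth (polycosecant_gf l n) m * t ^ m) sums eval_fps (polycosecant_gf l n) t"
      by (intro sums_eval_fps) auto
    with elim show ?case by (simp add: polycosecant_def)
  qed
  then show ?thesis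
    unfolding eventually_at_filter by eventually_elim (auto split: if_splits simp: mult.commute)
qed

end

theory Submission
  imports Defs
begin

text \<open>
  Put \<open>w = tanh (t/2) e\<^sup>y\<close>. Summing over the upper index, the Stirling numbers turn
  \<open>\<Sum>\<^sub>p w\<^sup>p\<close> into \<open>\<Sum>\<^sub>p p(p+1)\<cdots>(p+n-1) w\<^sup>p = n! w / (1-w)\<^sup>n\<^sup>+\<^sup>1\<close>, and the first half of the
  generating function becomes \<open>n! e\<^sup>t\<^sup>+\<^sup>y / (2 - (e\<^sup>t - 1)(e\<^sup>y - 1))\<^sup>n\<^sup>+\<^sup>1\<close>, which is symmetric in
  \<open>t\<close> and \<open>y\<close>. The second half is its reflection under \<open>t \<mapsto> -t\<close> and contributes the same
  coefficients in even degree. The bivariate series is replaced by its expansion in powers of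
  \<open>(e\<^sup>t - 1)(e\<^sup>y - 1)\<close>, whose coefficients are the finite sums in \<open>sym_polycosecant_even\<close>.
\<close>

text \<open>This is k! times the Stirling number of the second kind S(m+1, k+1), since e^t (e^t -
  1)^k is the derivative of (e^t - 1)^(k+1) / (k+1).\<close>

definition exp_power_coeff :: "nat \<Rightarrow> nat \<Rightarrow> complex" where
  "exp_power_coeff k m = fact m * fps_nth (fps_exp 1 * (fps_exp 1 - 1) ^ k) m"

lemma exp_power_coeff_eq_0:
  assumes "m < k"
  shows "exp_power_coeff k m = 0"
proof -
  have "fps_nth ((fps_exp 1 - 1 :: complex fps) ^ k) i = 0" if "i \<le> m" for i
    using startsby_zero_power_prefix[of "fps_exp 1 - 1 :: complex fps" k] that assms by simp
  then show ?thesis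
    by (simp add: exp_power_coeff_def fps_mult_nth)
qed

text \<open>Replacing t by ct scales the m-th coefficient by c^m. With c = -1 and m even this
  identifies the contributions of the two halves of the generating function.\<close>

lemma fps_nth_exp_mult_power:
  "fact m * fps_nth (fps_exp c * (fps_exp c - 1) ^ k) m = c ^ m * exp_power_coeff k m"
proof -
  have "fps_exp c * (fps_exp c - 1) ^ k =
      (fps_exp 1 * (fps_exp 1 - 1) ^ k) oo (fps_const c * fps_X)"
    by (simp add: fps_compose_mult_distrib fps_compose_power [symmetric] fps_compose_sub_distrib)
  then show ?thesis
    by (simp only: fps_nth_compose_linear exp_power_coeff_def mult.left_commute)
qed

text \<open>Compare the coefficients of t^l in e^((q+1)t) = e^t (1 + (e^t - 1))^q. The free bound
  \<open>K\<close> allows sums for different \<open>l\<close> to share one range.\<close>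

lemma of_nat_power_eq_sum_exp_power_coeff:
  assumes "l \<le> K"
  shows "of_nat (Suc q) ^ l = (\<Sum>k\<le>K. of_nat (q choose k) * exp_power_coeff k l)"
proof -
  have "fps_exp (of_nat (Suc q)) = fps_exp 1 * (fps_exp 1 - 1 + 1 :: complex fps) ^ q"
    by (simp add: fps_exp_power_mult flip: fps_exp_add_mult)
  also have "\<dots> = (\<Sum>k\<le>q. fps_const (of_nat (q choose k)) * (fps_exp 1 * (fps_exp 1 - 1) ^ k))"
    by (subst binomial_ring) (simp add: sum_distrib_left mult_ac fps_of_nat)
  finally have "fact l * fps_nth (fps_exp (of_nat (Suc q))) l =
      (\<Sum>k\<le>q. of_nat (q choose k) * exp_power_coeff k l)"
    by (simp only: fps_sum_nth sum_distrib_left exp_power_coeff_def fps_mult_left_const_nth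
          mult.left_commute[of "fact l :: complex"])
  \<comment> \<open>Beyond \<open>q\<close> the binomials vanish; beyond \<open>K\<close> the power
    (e^t - 1)^k has order greater than \<open>l\<close>.\<close>
  also have "\<dots> = (\<Sum>k\<le>max q K. of_nat (q choose k) * exp_power_coeff k l)"
    by (intro sum.mono_neutral_left) (auto simp: binomial_eq_0)
  also have "\<dots> = (\<Sum>k\<le>K. of_nat (q choose k) * exp_power_coeff k l)"
    using assms by (intro sum.mono_neutral_right) (auto simp: exp_power_coeff_eq_0)
  finally show ?thesis by (simp del: of_nat_Suc)
qed

lemma pochhammer_of_nat_Suc:
  "pochhammer (of_nat (Suc q)) n = (fact n * of_nat (q + n choose n) :: 'a :: field_char_0)"
  by (simp add: binomial_gbinomial gbinomial_pochhammer' add_ac)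

text \<open>For k \<le> q both sides are (q+n)! / (n! k! (q-k)!); otherwise both vanish.\<close>

lemma binomial_add_mult_binomial:
  "(q + n choose (n + k)) * (n + k choose k) = (q + n choose n) * (q choose k)"
proof (cases "k \<le> q")
  case True
  then show ?thesis
    using choose_mult[of n "n + k" "q + n"] binomial_symmetric[of k "n + k"] by simp
qed (simp add: binomial_eq_0)

text \<open>Negative binomial series, shifted by k+1. The case p = 0 is separate because truncated
  subtraction would give the binomial the value 1 when k = 0.\<close>

lemma fps_nth_X_power_over_one_minus_X_power:
  "fps_nth (fps_X ^ Suc k * inverse ((1 - fps_X) ^ Suc (n + k))) p =
     (if p = 0 then 0 else of_nat (p - 1 + n choose (n + k)) :: 'a :: field_char_0)"
proof -
  have inv: "inverse ((1 - fps_X :: 'a fps) ^ Suc (n + k)) =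
      Abs_fps (\<lambda>i. of_nat (n + k + i choose i))"
    using one_minus_const_fps_X_neg_power'[of "Suc (n + k)" "1 :: 'a"] by simp
  show ?thesis
  proof (cases "p \<le> k")
    case True
    then show ?thesis by (auto simp: fps_X_power_mult_nth binomial_eq_0 simp del: power_Suc)
  next
    case False
    then obtain i where "p = Suc k + i"
      by (metis less_imp_Suc_add not_le_imp_less add_Suc)
    then show ?thesis
      using binomial_symmetric[of i "n + k + i"]
      unfolding inv by (simp add: fps_X_power_mult_nth add_ac del: power_Suc)
  qed
qed

text \<open>At z^p the Stirling numbers produce p^l p(p+1)...(p+n-1). Expanding p^l in the binomials
  C(p-1, k) leaves multiples of C(p-1+n, n+k), the coefficients of the rational functions on the
  right.\<close>

lemma stirling_sum_polylog_fps:
  assumes "l \<le> K"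
  shows "(\<Sum>j=0..n. fps_const (of_nat (stirling n j)) * polylog_fps (- int (l + j))) =
    (\<Sum>k\<le>K. fps_const (fact n * of_nat (n + k choose k) * exp_power_coeff k l) *
       (fps_X ^ Suc k * inverse ((1 - fps_X) ^ Suc (n + k))))" (is "?L = ?R")
proof (rule fps_ext)
  fix p
  show "fps_nth ?L p = fps_nth ?R p"
  \<comment> \<open>The polylogarithm has no constant term, whereas the closed form p^l
    p(p+1)...(p+n-1) is 1 at p = l = n = 0.\<close>
  proof (cases p)
    case 0
    then show ?thesis by (simp add: fps_sum_nth polylog_fps_def)
  next
    case (Suc q)
    have "fps_nth ?L p = (\<Sum>j\<le>n. of_nat (stirling n j) * of_nat p ^ (l + j))"
      by (simp only: fps_sum_nth polylog_fps_def power_int_minus power_int_of_nat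
            fps_mult_left_const_nth fps_nth_Abs_fps atMost_atLeast0)
        (simp add: Suc divide_inverse del: of_nat_Suc)
    also have "\<dots> = of_nat p ^ l * pochhammer (of_nat p) n"
      by (simp add: sum_distrib_left power_add mult_ac flip: stirling_pochhammer)
    also have "\<dots> = (\<Sum>k\<le>K. fact n * exp_power_coeff k l *
        of_nat ((q + n choose n) * (q choose k)))"
      unfolding Suc of_nat_power_eq_sum_exp_power_coeff[OF assms] pochhammer_of_nat_Suc
      by (simp add: sum_distrib_left sum_distrib_right mult_ac)
    also have "\<dots> = fps_nth ?R p"
      unfolding binomial_add_mult_binomial[symmetric] fps_sum_nth fps_mult_left_const_nth
        fps_nth_X_power_over_one_minus_X_power
      by (simp add: Suc mult_ac)
    finally show ?thesis .
  qed
qed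

lemma fps_tanh_half_mult: "fps_tanh (c/2) * (fps_exp c + 1) = fps_exp c - 1"
proof -
  define e where "e = fps_exp (c/2)"
  define d where "d = fps_exp (-(c/2))"
  have ed: "e * d = 1" "fps_exp c = e * e"
    by (simp_all add: e_def d_def flip: fps_exp_add_mult)
  have "fps_nth (fps_cosh (c/2)) 0 \<noteq> 0"
    by (simp add: fps_cosh_def)
  then have "fps_tanh (c/2) * fps_cosh (c/2) = fps_sinh (c/2)"
    by (simp add: fps_tanh_def fps_divide_unit mult.assoc inverse_mult_eq_1)
  \<comment> \<open>The factor 2 e^(ct/2) turns cosh(ct/2) and sinh(ct/2) into e^(ct) + 1 and e^(ct)
    - 1.\<close>
  then have "fps_tanh (c/2) * (fps_const 2 * e * fps_cosh (c/2)) = fps_const 2 * e * fps_sinh (c/2)"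
    by (simp add: mult_ac)
  moreover have "fps_const 2 * e * fps_cosh (c/2) = (fps_const 2 * fps_const (1/2)) * (e * e + e * d)"
    by (simp only: fps_cosh_def e_def d_def algebra_simps)
  moreover have "fps_const 2 * e * fps_sinh (c/2) = (fps_const 2 * fps_const (1/2)) * (e * e - e * d)"
    by (simp only: fps_sinh_def e_def d_def algebra_simps)
  ultimately show ?thesis by (simp add: ed)
qed

lemma fps_nth_tanh_0 [simp]: "fps_nth (fps_tanh c) 0 = 0"
  by (simp add: fps_tanh_def fps_sinh_def fps_cosh_def fps_divide_unit)

lemma fps_sinh_minus: "fps_sinh (- c) = - fps_sinh c"
  by (simp add: fps_sinh_def algebra_simps)

lemma fps_tanh_minus: "fps_tanh (- c) = - fps_tanh c"
proof -
  have "fps_cosh (- c) = fps_cosh c" by (simp add: fps_cosh_def add.commute)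
  then show ?thesis
    by (simp add: fps_tanh_def fps_sinh_minus fps_divide_uminus)
qed

text \<open>From 2 sinh(ct) = e^(-ct) (e^(ct) - 1)(e^(ct) + 1). Since \<open>fps_sinh c\<close> is
  not a unit, exhibiting it as a factor is what makes the later division exact.\<close>

lemma fps_exp_minus_one_eq_sinh_mult:
  "fps_exp c - 1 = fps_sinh c * (fps_const 2 * fps_exp c * inverse (fps_exp c + 1))"
proof -
  have ed: "fps_exp c * fps_exp (- c) = 1"
    by (simp flip: fps_exp_add_mult)
  have "fps_sinh c * (fps_const 2 * fps_exp c) =
      (fps_const 2 * fps_const (1/2)) * (fps_exp c * fps_exp c - fps_exp c * fps_exp (- c))"
    by (simp only: fps_sinh_def algebra_simps)
  also have "\<dots> = (fps_exp c - 1) * (fps_exp c + 1)"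
    unfolding ed by (simp add: algebra_simps)
  finally have "fps_sinh c * (fps_const 2 * fps_exp c) * inverse (fps_exp c + 1) =
      (fps_exp c - 1) * ((fps_exp c + 1) * inverse (fps_exp c + 1))"
    by (simp add: mult.assoc)
  then show ?thesis
    by (simp add: inverse_mult_eq_1' mult.assoc)
qed

text \<open>Division by \<open>g\<close> is multiplication by a fixed series followed by a shift,
  hence linear in the numerator even when it is not exact.\<close>

lemma fps_divide_sum_const_mult:
  fixes f :: "'b \<Rightarrow> 'a :: field fps"
  shows "(\<Sum>j\<in>A. fps_const (c j) * f j) / g = (\<Sum>j\<in>A. fps_const (c j) * (f j / g))"
  by (rule fps_ext) (simp add: fps_divide_def sum_distrib_right fps_sum_nth mult.assoc)

text \<open>Write E = e^(ct) and T = (E-1)/(E+1), so that 1-T = 2/(E+1). Then T^(k+1) /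
  (1-T)^(n+k+1) = (E-1)^(k+1) (E+1)^n / 2^(n+k+1), and one factor E-1 absorbs the division by
  sinh(ct).\<close>

lemma compose_tanh_half_over_sinh:
  assumes "c \<noteq> 0"
  shows "((fps_X ^ Suc k * inverse ((1 - fps_X) ^ Suc (n + k))) oo fps_tanh (c/2)) / fps_sinh c =
    fps_const (1 / 2 ^ (n + k)) * fps_exp c * (fps_exp c - 1) ^ k *
      (fps_exp c + 1) ^ n * inverse (fps_exp c + 1)" (is "(?Q oo ?T) / ?S = ?R")
proof -
  define E where "E = fps_exp c"
  have "?Q * (1 - fps_X) ^ Suc (n + k) = (fps_X :: complex fps) ^ Suc k"
    by (simp only: mult.assoc, subst inverse_mult_eq_1) simp_all
  then have "(?Q oo ?T) * (1 - ?T) ^ Suc (n + k) = ?T ^ Suc k"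
    by (metis fps_compose_mult_distrib fps_compose_power fps_compose_sub_distrib fps_compose_1
        fps_X_fps_compose_startby0 fps_nth_tanh_0)
  then have "(?Q oo ?T) * ((1 - ?T) * (E + 1)) ^ Suc (n + k) =
      (?T * (E + 1)) ^ Suc k * (E + 1) ^ n"
    by (simp add: power_mult_distrib power_add mult_ac)
  moreover have "(1 - ?T) * (E + 1) = fps_const 2"
    using fps_tanh_half_mult[of c] by (simp add: E_def algebra_simps flip: numeral_fps_const)
  ultimately have "(?Q oo ?T) * fps_const 2 ^ Suc (n + k) = (E - 1) ^ Suc k * (E + 1) ^ n"
    using fps_tanh_half_mult[of c] by (simp only: E_def)
  then have "(?Q oo ?T) * fps_const 2 ^ Suc (n + k) * fps_const (1 / 2 ^ Suc (n + k)) =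
      (E - 1) ^ k * (E + 1) ^ n * (E - 1) * fps_const (1 / 2 ^ Suc (n + k))"
    by (simp add: mult_ac)
  moreover have "fps_const 2 ^ Suc (n + k) * fps_const (1 / 2 ^ Suc (n + k)) = (1 :: complex fps)"
    by (simp del: power_Suc)
  ultimately have "?Q oo ?T = (E - 1) ^ k * (E + 1) ^ n * (E - 1) * fps_const (1 / 2 ^ Suc (n + k))"
    by (simp only: mult.assoc mult_1_right)
  also have "\<dots> = ?S * ((fps_const 2 * fps_const (1 / 2 ^ Suc (n + k))) * E * (E - 1) ^ k *
      (E + 1) ^ n * inverse (E + 1))"
    by (subst (2) fps_exp_minus_one_eq_sinh_mult[of c, folded E_def]) (simp only: mult_ac)
  also have "fps_const 2 * fps_const (1 / 2 ^ Suc (n + k)) = (fps_const (1 / 2 ^ (n + k)) :: complex fps)"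
    by simp
  finally have "?Q oo ?T = ?S * ?R" by (simp only: E_def)
  moreover have "?S \<noteq> 0"
  proof
    assume "?S = 0"
    then have "fps_nth ?S 1 = 0" by simp
    then show False using assms by (simp add: fps_sinh_def)
  qed
  ultimately show ?thesis by simp
qed

lemma powi_one_minus_mult_power:
  fixes f :: "'a :: field fps"
  assumes "fps_nth f 0 \<noteq> 0"
  shows "f powi (1 - int n) * f ^ n * inverse f = 1"
proof (cases n)
  case 0
  then show ?thesis using assms by (simp add: inverse_mult_eq_1')
next
  case (Suc q)
  have "f powi (1 - int n) = inverse f ^ q"
    by (cases "q = 0") (auto simp: Suc power_int_def)
  moreover have "inverse f ^ q * f ^ q = 1" "f * inverse f = 1"
    using assms by (simp_all add: inverse_mult_eq_1 inverse_mult_eq_1' flip: power_mult_distrib)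
  ultimately show ?thesis
    by (simp add: Suc) (metis mult.assoc mult.commute mult.right_neutral)
qed

text \<open>For \<open>c = 1\<close> and \<open>c = -1\<close> this covers the two summands of \<open>polycosecant_gf\<close>.\<close>
lemma stirling_sum_half_gf:
  assumes "c \<noteq> 0" "l \<le> K"
  shows "(\<Sum>j=0..n. fps_const (of_nat (stirling n j)) *
      (fps_const (1/2) * (fps_exp c + 1) powi (1 - int n) *
        ((polylog_fps (- int (l + j)) oo fps_tanh (c/2)) / fps_sinh c))) =
    (\<Sum>k\<le>K. fps_const (fact n * of_nat (n + k choose k) / 2 ^ Suc (n + k) * exp_power_coeff k l) *
      (fps_exp c * (fps_exp c - 1) ^ k))" (is "?L = _")
proof -
  let ?W = "(fps_exp c + 1) powi (1 - int n)" and ?T = "fps_tanh (c/2)"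
  let ?a = "\<lambda>k. fact n * of_nat (n + k choose k) * exp_power_coeff k l"
  let ?Q = "\<lambda>k. fps_X ^ Suc k * inverse ((1 - fps_X) ^ Suc (n + k)) :: complex fps"
  have "?L = fps_const (1/2) * ?W *
      (((\<Sum>j=0..n. fps_const (of_nat (stirling n j)) * polylog_fps (- int (l + j))) oo ?T) / fps_sinh c)"
    by (simp only: fps_compose_sum_distrib fps_const_mult_apply_left [symmetric]
          fps_divide_sum_const_mult sum_distrib_left mult_ac)
  also have "\<dots> = (\<Sum>k\<le>K. fps_const (1/2) * ?W * (fps_const (?a k) * ((?Q k oo ?T) / fps_sinh c)))"
    by (simp only: stirling_sum_polylog_fps[OF assms(2)] fps_compose_sum_distrib
          fps_const_mult_apply_left [symmetric] fps_divide_sum_const_mult sum_distrib_left)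
  \<comment> \<open>The last bracket is 1: the weight (e^(ct) + 1)^(1-n) cancels exactly what the
    substitution produced.\<close>
  also have "\<dots> = (\<Sum>k\<le>K. (fps_const (1/2) * fps_const (?a k) * fps_const (1 / 2 ^ (n + k))) *
      (fps_exp c * (fps_exp c - 1) ^ k) * (?W * (fps_exp c + 1) ^ n * inverse (fps_exp c + 1)))"
    by (simp only: compose_tanh_half_over_sinh[OF assms(1)] mult_ac)
  also have "\<dots> = (\<Sum>k\<le>K. fps_const (fact n * of_nat (n + k choose k) / 2 ^ Suc (n + k) *
      exp_power_coeff k l) * (fps_exp c * (fps_exp c - 1) ^ k))"
    by (subst powi_one_minus_mult_power) (simp_all add: field_simps)
  finally show ?thesis .
qed

text \<open>For even \<open>m\<close> the halves c = 1 and c = -1 contribute equally, which removes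
  the factor 1/2. The summand is symmetric in \<open>l\<close> and \<open>m\<close>.\<close>

lemma sym_polycosecant_even:
  assumes "even m" "l \<le> K"
  shows "sym_polycosecant m l n = (\<Sum>k\<le>K. fact n * of_nat (n + k choose k) / 2 ^ (n + k) *
    exp_power_coeff k l * exp_power_coeff k m)"
proof -
  let ?b = "\<lambda>k. fact n * of_nat (n + k choose k) / 2 ^ Suc (n + k) * exp_power_coeff k l"
  let ?h = "\<lambda>c j. fps_const (1/2) * (fps_exp c + 1) powi (1 - int n) *
        ((polylog_fps (- int (l + j)) oo fps_tanh (c/2)) / fps_sinh c)"
  have gf: "polycosecant_gf (l + j) n = ?h 1 j + ?h (- 1) j" for j
    using fps_tanh_minus[of "1/2"] by (simp add: polycosecant_gf_def)
  have half: "fact m * fps_nth (\<Sum>j=0..n. fps_const (of_nat (stirling n j)) * ?h c j) m =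
      (\<Sum>k\<le>K. ?b k * exp_power_coeff k m)" if "c \<noteq> 0" "c ^ m = 1" for c
  proof -
    have "fact m * fps_nth (\<Sum>k\<le>K. fps_const (?b k) * (fps_exp c * (fps_exp c - 1) ^ k)) m =
        (\<Sum>k\<le>K. ?b k * (fact m * fps_nth (fps_exp c * (fps_exp c - 1) ^ k) m))"
      by (simp only: fps_sum_nth fps_mult_left_const_nth sum_distrib_left
            mult.left_commute[of "fact m :: complex"])
    also have "\<dots> = (\<Sum>k\<le>K. ?b k * exp_power_coeff k m)"
      by (simp only: fps_nth_exp_mult_power that mult_1_left)
    finally show ?thesis
      by (simp only: stirling_sum_half_gf[OF that(1) assms(2)])
  qed
  have "sym_polycosecant m l n =
      fact m * fps_nth (\<Sum>j=0..n. fps_const (of_nat (stirling n j)) * ?h 1 j) m +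
      fact m * fps_nth (\<Sum>j=0..n. fps_const (of_nat (stirling n j)) * ?h (- 1) j) m"
    by (simp only: sym_polycosecant_def polycosecant_def gf fps_sum_nth fps_mult_left_const_nth
          fps_add_nth distrib_left sum.distrib sum_distrib_left mult_ac)
  also have "\<dots> = (\<Sum>k\<le>K. ?b k * exp_power_coeff k m) + (\<Sum>k\<le>K. ?b k * exp_power_coeff k m)"
    using assms(1) by (subst (1 2) half) simp_all
  also have "\<dots> = (\<Sum>k\<le>K. fact n * of_nat (n + k choose k) / 2 ^ (n + k) *
      exp_power_coeff k l * exp_power_coeff k m)"
    unfolding sum.distrib [symmetric] by (intro sum.cong) (simp_all add: field_simps)
  finally show ?thesis .
qed

theorem theorem4p6:
  fixes l m n :: nat
  shows "sym_polycosecant (2 * m) (2 * l) n = sym_polycosecant (2 * l) (2 * m) n"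
  \<comment> \<open>The bound 2(l+m) dominates both upper indices, so both sides become sums over
    the same range.\<close>
  by (simp add: sym_polycosecant_even[of _ _ "2 * (l + m)"] mult_ac)

end
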